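(* Let $y:[0,\tau_f]\to\mathbb{R}^{n_y}$ be a solution of the time-freezing system with friction $y'\in F_{\mathrm{TF}}(y,u)$ (defined in the context, using the auxiliary dynamics $f_{\mathrm{aux,n}}$, $f^{\pm}_{\mathrm{aux,t}}$ given there), with $y(0)\in\Sigma$, and suppose that $\varphi(x(\tau),u(\tau))\le0$ for all $\tau\in[0,\tau_f]$ (persistent contact). Then: (i) if $v_{\mathrm{t}}\neq0$ (slip motion), the sliding mode dynamics are given by $y'=\gamma(x,u)\,(f_{\mathrm{Slip}}(x,u),1)$; (ii) if $v_{\mathrm{t}}=0$ (stick motion), the sliding mode dynamics are given by $y'=\gamma(x,u)\,(f_{\mathrm{Stick}}(x,u),1)$, where $\gamma(x,u)\in(0,1]$ is the time-rescaling factor $\gamma(x,u)=\dfrac{D(q)a_{\mathrm{n}}}{D(q)a_{\mathrm{n}}-\varphi(x,u)}$.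
   Context: Let $f_v:\mathbb{R}^{n_q}\times\mathbb{R}^{n_q}\times\mathbb{R}^{n_u}\to\mathbb{R}^{n_q}$, $M:\mathbb{R}^{n_q}\to\mathbb{R}^{n_q\times n_q}$ (symmetric positive definite values) and $f_c:\mathbb{R}^{n_q}\to\mathbb{R}$ be at least twice continuously differentiable; $x=(q,v)$, $n(q):=\nabla_qf_c(q)$. Planar contact: $b:\mathbb{R}^{n_q}\to\mathbb{R}^{n_q}$ (smooth) spans the tangent space at contact points, and it is assumed that $b(q)^\top M(q)^{-1}n(q)=0$. Tangential velocity $v_{\mathrm{t}}:=b(q)^\top v$. Coefficient of friction $\mu>0$. Define $D(q):=n(q)^\top M(q)^{-1}n(q)$, $\varphi(x,u):=n(q)^\top f_v(q,v,u)+\nabla_q(n(q)^\top v)^\top v$, and with $N(q):=[n(q)\ b(q)]\in\mathbb{R}^{n_q\times2}$: $\tilde D(q):=N(q)^\top M(q)^{-1}N(q)$, $\tilde\varphi(x,u):=N(q)^\top f_v(q,v,u)+\nabla_q(N(q)^\top v)^\top v$. Let $f_{\mathrm{ODE}}(x,u)=(v,f_v(q,v,u))$, $f_{\mathrm{Slip}}(x,u):=\big(v,\ f_v(q,v,u)-M(q)^{-1}D(q)^{-1}\varphi(x,u)\,(n(q)-b(q)\mu\,\tfrac{v_{\mathrm{t}}}{|v_{\mathrm{t}}|})\big)$, $f_{\mathrm{Stick}}(x,u):=\big(v,\ f_v(q,v,u)-M(q)^{-1}N(q)\tilde D(q)^{-1}\tilde\varphi(x,u)\big)$. Time-freezing system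 with friction: state $y=(x,t)\in\mathbb{R}^{n_y}$, $n_y=2n_q+1$, clock state $t$, numerical time $\tau$, $y'=\mathrm{d}y/\mathrm{d}\tau$, given control $u(\tau)$. Switching functions $c_1(y)=f_c(q)$, $c_2(y)=n(q)^\top v$, $c_3(y)=b(q)^\top v$; $Q:=\{y: c_1(y)<0,\ c_2(y)<0\}$; regions $R_1=\{c_1>0\}\cup\{c_1<0,\ c_2>0\}$, $R_2=Q\cap\{c_3>0\}$, $R_3=Q\cap\{c_3<0\}$. With constants $a_{\mathrm{n}}>0$ and $a_{\mathrm{t}}=\mu a_{\mathrm{n}}$, set $f_{\mathrm{aux,n}}(y)=(\mathbf{0}_{n_q,1},M(q)^{-1}n(q)a_{\mathrm{n}},0)$, $f^-_{\mathrm{aux,t}}(y)=(\mathbf{0}_{n_q,1},M(q)^{-1}b(q)a_{\mathrm{t}},0)$, $f^+_{\mathrm{aux,t}}=-f^-_{\mathrm{aux,t}}$, and $f_1(y,u)=(f_{\mathrm{ODE}}(x,u),1)$, $f_2=f_{\mathrm{aux,n}}+f^+_{\mathrm{aux,t}}$, $f_3=f_{\mathrm{aux,n}}+f^-_{\mathrm{aux,t}}$. The time-freezing system is the Filippov inclusion $y'\in F_{\mathrm{TF}}(y,u):=\{\sum_{i=1}^3\theta_if_i\mid\sum_i\theta_i=1,\ \theta\ge0,\ \theta_i=0\text{ if }y\notin\overline{R_i}\}$. Let $\Sigma:=\{y\mid f_c(q)=0,\ n(q)^\top v=0\}$; a sliding mode is an evolution on $\Sigma$. *)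

theory Defs
  imports "HOL-Analysis.Analysis"
begin

definition grad :: "(real^'n \<Rightarrow> real) \<Rightarrow> real^'n \<Rightarrow> real^'n" where
  "grad f q = (\<chi> i. frechet_derivative f (at q) (axis i 1))"

definition C1_fun :: "('a::euclidean_space \<Rightarrow> 'b::real_normed_vector) \<Rightarrow> bool" where
  "C1_fun f \<longleftrightarrow> (\<forall>x. f differentiable (at x)) \<and>
     (\<forall>h. continuous_on UNIV (\<lambda>x. frechet_derivative f (at x) h))"

definition C2_fun :: "('a::euclidean_space \<Rightarrow> 'b::real_normed_vector) \<Rightarrow> bool" where
  "C2_fun f \<longleftrightarrow> C1_fun f \<and> (\<forall>h. C1_fun (\<lambda>x. frechet_derivative f (at x) h))"

definition dirterm :: "(real^'n \<Rightarrow> real^'n) \<Rightarrow> real^'n \<Rightarrow> real^'n \<Rightarrow> real" where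
  "dirterm g q v = frechet_derivative (\<lambda>p. g p \<bullet> v) (at q) v"

definition Minv :: "(real^'n \<Rightarrow> real^'n^'n) \<Rightarrow> real^'n \<Rightarrow> real^'n^'n" where
  "Minv M q = matrix_inv (M q)"

definition Dfun :: "(real^'n \<Rightarrow> real^'n^'n) \<Rightarrow> (real^'n \<Rightarrow> real) \<Rightarrow> real^'n \<Rightarrow> real" where
  "Dfun M fc q = grad fc q \<bullet> (Minv M q *v grad fc q)"

definition phi :: "(real^'n \<Rightarrow> real^'n \<Rightarrow> real^'m \<Rightarrow> real^'n) \<Rightarrow> (real^'n \<Rightarrow> real)
    \<Rightarrow> (real^'n) \<times> (real^'n) \<Rightarrow> real^'m \<Rightarrow> real" where
  "phi fv fc x u = (let q = fst x; v = snd x in grad fc q \<bullet> fv q v u + dirterm (grad fc) q v)"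

definition Ntr :: "(real^'n \<Rightarrow> real) \<Rightarrow> (real^'n \<Rightarrow> real^'n) \<Rightarrow> real^'n \<Rightarrow> real^'n^2" where
  "Ntr fc b q = vector [grad fc q, b q]"

definition Dtilde :: "(real^'n \<Rightarrow> real^'n^'n) \<Rightarrow> (real^'n \<Rightarrow> real) \<Rightarrow> (real^'n \<Rightarrow> real^'n)
    \<Rightarrow> real^'n \<Rightarrow> real^2^2" where
  "Dtilde M fc b q = Ntr fc b q ** Minv M q ** transpose (Ntr fc b q)"

definition phitilde :: "(real^'n \<Rightarrow> real^'n \<Rightarrow> real^'m \<Rightarrow> real^'n) \<Rightarrow> (real^'n \<Rightarrow> real)
    \<Rightarrow> (real^'n \<Rightarrow> real^'n) \<Rightarrow> (real^'n) \<times> (real^'n) \<Rightarrow> real^'m \<Rightarrow> real^2" where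
  "phitilde fv fc b x u = (let q = fst x; v = snd x in
     Ntr fc b q *v fv q v u + vector [dirterm (grad fc) q v, dirterm b q v])"

definition fSlip :: "(real^'n \<Rightarrow> real^'n \<Rightarrow> real^'m \<Rightarrow> real^'n) \<Rightarrow> (real^'n \<Rightarrow> real^'n^'n)
    \<Rightarrow> (real^'n \<Rightarrow> real) \<Rightarrow> (real^'n \<Rightarrow> real^'n) \<Rightarrow> real
    \<Rightarrow> (real^'n) \<times> (real^'n) \<Rightarrow> real^'m \<Rightarrow> (real^'n) \<times> (real^'n)" where
  "fSlip fv M fc b mu x u = (let q = fst x; v = snd x; vt = b q \<bullet> v in
     (v, fv q v u - Minv M q *v ((phi fv fc x u / Dfun M fc q) *\<^sub>R
            (grad fc q - (mu * (vt / \<bar>vt\<bar>)) *\<^sub>R b q))))"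

definition fStick :: "(real^'n \<Rightarrow> real^'n \<Rightarrow> real^'m \<Rightarrow> real^'n) \<Rightarrow> (real^'n \<Rightarrow> real^'n^'n)
    \<Rightarrow> (real^'n \<Rightarrow> real) \<Rightarrow> (real^'n \<Rightarrow> real^'n)
    \<Rightarrow> (real^'n) \<times> (real^'n) \<Rightarrow> real^'m \<Rightarrow> (real^'n) \<times> (real^'n)" where
  "fStick fv M fc b x u = (let q = fst x; v = snd x in
     (v, fv q v u - Minv M q *v (transpose (Ntr fc b q) *v
            (matrix_inv (Dtilde M fc b q) *v phitilde fv fc b x u))))"

definition gammaTF :: "(real^'n \<Rightarrow> real^'n \<Rightarrow> real^'m \<Rightarrow> real^'n) \<Rightarrow> (real^'n \<Rightarrow> real^'n^'n)
    \<Rightarrow> (real^'n \<Rightarrow> real) \<Rightarrow> real \<Rightarrow> (real^'n) \<times> (real^'n) \<Rightarrow> real^'m \<Rightarrow> real" where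
  "gammaTF fv M fc an x u =
     Dfun M fc (fst x) * an / (Dfun M fc (fst x) * an - phi fv fc x u)"

text \<open>Time-freezing state y = ((q, v), t).  Switching functions and regions.\<close>
type_synonym 'n tfstate = "((real^'n) \<times> (real^'n)) \<times> real"

definition c1 :: "(real^'n \<Rightarrow> real) \<Rightarrow> 'n tfstate \<Rightarrow> real" where
  "c1 fc y = fc (fst (fst y))"
definition c2 :: "(real^'n \<Rightarrow> real) \<Rightarrow> 'n tfstate \<Rightarrow> real" where
  "c2 fc y = grad fc (fst (fst y)) \<bullet> snd (fst y)"
definition c3 :: "(real^'n \<Rightarrow> real^'n) \<Rightarrow> 'n tfstate \<Rightarrow> real" where
  "c3 b y = b (fst (fst y)) \<bullet> snd (fst y)"

definition regionQ :: "(real^'n \<Rightarrow> real) \<Rightarrow> 'n tfstate set" where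
  "regionQ fc = {y. c1 fc y < 0 \<and> c2 fc y < 0}"
definition region1 :: "(real^'n \<Rightarrow> real) \<Rightarrow> 'n tfstate set" where
  "region1 fc = {y. c1 fc y > 0} \<union> {y. c1 fc y < 0 \<and> c2 fc y > 0}"
definition region2 :: "(real^'n \<Rightarrow> real) \<Rightarrow> (real^'n \<Rightarrow> real^'n) \<Rightarrow> 'n tfstate set" where
  "region2 fc b = regionQ fc \<inter> {y. c3 b y > 0}"
definition region3 :: "(real^'n \<Rightarrow> real) \<Rightarrow> (real^'n \<Rightarrow> real^'n) \<Rightarrow> 'n tfstate set" where
  "region3 fc b = regionQ fc \<inter> {y. c3 b y < 0}"

definition Sigma_TF :: "(real^'n \<Rightarrow> real) \<Rightarrow> 'n tfstate set" where
  "Sigma_TF fc = {y. c1 fc y = 0 \<and> c2 fc y = 0}"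

definition f1TF :: "(real^'n \<Rightarrow> real^'n \<Rightarrow> real^'m \<Rightarrow> real^'n) \<Rightarrow> 'n tfstate \<Rightarrow> real^'m \<Rightarrow> 'n tfstate" where
  "f1TF fv y u = (let q = fst (fst y); v = snd (fst y) in ((v, fv q v u), 1))"

definition f_aux_n :: "(real^'n \<Rightarrow> real^'n^'n) \<Rightarrow> (real^'n \<Rightarrow> real) \<Rightarrow> real \<Rightarrow> 'n tfstate \<Rightarrow> 'n tfstate" where
  "f_aux_n M fc an y = (let q = fst (fst y) in ((0, Minv M q *v (an *\<^sub>R grad fc q)), 0))"

definition f_aux_t_minus :: "(real^'n \<Rightarrow> real^'n^'n) \<Rightarrow> (real^'n \<Rightarrow> real^'n) \<Rightarrow> real \<Rightarrow> 'n tfstate \<Rightarrow> 'n tfstate" where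
  "f_aux_t_minus M b a_t y = (let q = fst (fst y) in ((0, Minv M q *v (a_t *\<^sub>R b q)), 0))"

definition f_aux_t_plus :: "(real^'n \<Rightarrow> real^'n^'n) \<Rightarrow> (real^'n \<Rightarrow> real^'n) \<Rightarrow> real \<Rightarrow> 'n tfstate \<Rightarrow> 'n tfstate" where
  "f_aux_t_plus M b a_t y = - f_aux_t_minus M b a_t y"

definition F_TF :: "(real^'n \<Rightarrow> real^'n \<Rightarrow> real^'m \<Rightarrow> real^'n) \<Rightarrow> (real^'n \<Rightarrow> real^'n^'n)
    \<Rightarrow> (real^'n \<Rightarrow> real) \<Rightarrow> (real^'n \<Rightarrow> real^'n) \<Rightarrow> real \<Rightarrow> real
    \<Rightarrow> 'n tfstate \<Rightarrow> real^'m \<Rightarrow> 'n tfstate set" where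
  "F_TF fv M fc b mu an y u =
     {th1 *\<^sub>R f1TF fv y u
      + th2 *\<^sub>R (f_aux_n M fc an y + f_aux_t_plus M b (mu * an) y)
      + th3 *\<^sub>R (f_aux_n M fc an y + f_aux_t_minus M b (mu * an) y) | th1 th2 th3.
        th1 \<ge> 0 \<and> th2 \<ge> 0 \<and> th3 \<ge> 0 \<and> th1 + th2 + th3 = 1 \<and>
        (y \<notin> closure (region1 fc) \<longrightarrow> th1 = 0) \<and>
        (y \<notin> closure (region2 fc b) \<longrightarrow> th2 = 0) \<and>
        (y \<notin> closure (region3 fc b) \<longrightarrow> th3 = 0)}"

text \<open>Filippov (Caratheodory) solution on [0, tf]: y is absolutely continuous with
  derivative y' (given as an integrable function with y(s) = y(0) + int_0^s y'), and
  y'(s) is in F_TF(y(s), u(s)) for almost every s in [0, tf].\<close>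
definition TF_solution :: "(real^'n \<Rightarrow> real^'n \<Rightarrow> real^'m \<Rightarrow> real^'n) \<Rightarrow> (real^'n \<Rightarrow> real^'n^'n)
    \<Rightarrow> (real^'n \<Rightarrow> real) \<Rightarrow> (real^'n \<Rightarrow> real^'n) \<Rightarrow> real \<Rightarrow> real
    \<Rightarrow> (real \<Rightarrow> real^'m) \<Rightarrow> real \<Rightarrow> (real \<Rightarrow> 'n tfstate) \<Rightarrow> (real \<Rightarrow> 'n tfstate) \<Rightarrow> bool" where
  "TF_solution fv M fc b mu an u tf y y' \<longleftrightarrow>
     y' absolutely_integrable_on {0..tf} \<and>
     (\<forall>s\<in>{0..tf}. y s = y 0 + integral {0..s} y') \<and>
     (AE s in lborel. s \<in> {0..tf} \<longrightarrow> y' s \<in> F_TF fv M fc b mu an (y s) (u s))"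

end

theory Submission
  imports Defs
begin

text \<open>Along a solution, the switching functions \<open>c1\<close>, \<open>c2\<close>, \<open>c3\<close> are absolutely continuous, and the
  chain rule expresses their derivatives by the convex multipliers. A sign argument based on
  \<open>\<phi> \<le> 0\<close> shows that the solution cannot leave \<open>\<Sigma>\<close>. As \<open>c2 = 0\<close> throughout, its derivative
  \<open>\<theta>\<^sub>1 \<phi> + (1 - \<theta>\<^sub>1) D a\<^sub>n\<close> vanishes, which gives \<open>\<theta>\<^sub>1 = \<gamma>\<close>. If \<open>c3 \<noteq> 0\<close>, only one of the two
  auxiliary fields is active, which yields the slip dynamics. On the set \<open>c3 = 0\<close> the derivative
  of \<open>c3\<close> vanishes almost everywhere; this determines \<open>\<theta>\<^sub>3 - \<theta>\<^sub>2\<close>, and because \<open>b\<close> and \<open>n\<close> are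
  orthogonal with respect to \<open>M\<^sup>-\<^sup>1\<close>, the matrix \<open>Dtilde\<close> is diagonal and the stick dynamics
  result.\<close>

subsection \<open>Absolutely continuous curves\<close>

text \<open>The integral equation is stated as a difference because
  \<open>y s = y a + integral {a..s} y'\<close>, used as a rewrite rule, loops at \<open>s = a\<close>.\<close>
definition ac_deriv :: "(real \<Rightarrow> 'a::euclidean_space) \<Rightarrow> (real \<Rightarrow> 'a) \<Rightarrow> real \<Rightarrow> real \<Rightarrow> bool" where
  "ac_deriv y y' a b \<longleftrightarrow> y' absolutely_integrable_on {a..b} \<and>
     (\<forall>s\<in>{a..b}. integral {a..s} y' = y s - y a)"

section \<open>Chain rule for C1 functions along absolutely continuous curves\<close>

text \<open>Continuity on the finitely many basis vectors gives continuity in operator norm, since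
  \<open>onorm\<close> is at most the sum over the basis; the mean value inequality on a ball does
  the rest. Two free points \<open>z\<close> and \<open>w\<close> allow both ends of an interval to
  be compared while the derivative is taken at its tag.\<close>

lemma C1_strict_derivative:
  fixes \<Phi> :: "'a::euclidean_space \<Rightarrow> 'b::real_normed_vector"
  assumes deriv: "\<And>x. (\<Phi> has_derivative \<Phi>' x) (at x)"
    and cont: "\<And>h. continuous_on UNIV (\<lambda>x. \<Phi>' x h)"
    and e: "e > 0"
  obtains d where "d > 0"
    "\<And>z w. z \<in> ball x d \<Longrightarrow> w \<in> ball x d \<Longrightarrow>
       norm (\<Phi> z - \<Phi> w - \<Phi>' x (z - w)) \<le> e * norm (z - w)"
proof -
  have bl: "bounded_linear (\<Phi>' w)" for w
    using deriv has_derivative_bounded_linear by blast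
  have "eventually (\<lambda>w. norm (\<Phi>' w i - \<Phi>' x i) < e / real DIM('a)) (nhds x)" if "i \<in> Basis" for i
  proof -
    have "isCont (\<lambda>w. \<Phi>' w i) x"
      using cont[of i] by (simp add: continuous_on_eq_continuous_at)
    then have "((\<lambda>w. \<Phi>' w i) \<longlongrightarrow> \<Phi>' x i) (nhds x)"
      by (simp add: isCont_def tendsto_nhds_iff)
    then have "eventually (\<lambda>w. dist (\<Phi>' w i) (\<Phi>' x i) < e / real DIM('a)) (nhds x)"
      using e by (intro tendstoD) auto
    then show ?thesis by (simp add: dist_norm)
  qed
  then have "eventually (\<lambda>w. \<forall>i\<in>Basis. norm (\<Phi>' w i - \<Phi>' x i) < e / real DIM('a)) (nhds x)"
    by (simp add: eventually_ball_finite)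
  then obtain d where d: "d > 0"
    "\<And>w. dist w x < d \<Longrightarrow> \<forall>i\<in>Basis. norm (\<Phi>' w i - \<Phi>' x i) < e / real DIM('a)"
    unfolding eventually_nhds_metric by blast
  have on: "onorm (\<Phi>' w - \<Phi>' x) \<le> e" if "w \<in> ball x d" for w
  proof -
    have "bounded_linear (\<Phi>' w - \<Phi>' x)"
      using bounded_linear_sub[OF bl bl] by (simp add: fun_diff_def)
    then have "onorm (\<Phi>' w - \<Phi>' x) \<le> (\<Sum>i\<in>Basis. norm ((\<Phi>' w - \<Phi>' x) i))"
      by (rule onorm_componentwise)
    also have "\<dots> \<le> (\<Sum>i\<in>(Basis::'a set). e / real DIM('a))"
      using d(2)[of w] that by (intro sum_mono) (auto simp: dist_commute less_imp_le)
    also have "\<dots> = e" by simp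
    finally show ?thesis .
  qed
  show thesis
  proof (rule that[OF d(1)])
    fix z w assume zw: "z \<in> ball x d" "w \<in> ball x d"
    have "norm (\<Phi> z - \<Phi> w - \<Phi>' x (z - w)) \<le> norm (z - w) * e"
    proof (rule differentiable_bound_linearization[where S = "ball x d"])
      show "w + t *\<^sub>R (z - w) \<in> ball x d" if "t \<in> {0..1}" for t
        using convexD_alt[OF convex_ball zw(2,1), of t] that by (simp add: algebra_simps)
      show "(\<Phi> has_derivative \<Phi>' v) (at v within ball x d)" for v
        using deriv has_derivative_at_withinI by blast
      show "onorm (\<Phi>' v - \<Phi>' x) \<le> e" if "v \<in> ball x d" for v
        using on that .
      show "x \<in> ball x d" using d by simp
    qed
    then show "norm (\<Phi> z - \<Phi> w - \<Phi>' x (z - w)) \<le> e * norm (z - w)"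
      by (simp add: mult.commute)
  qed
qed

lemma ac_deriv_subinterval:
  assumes "ac_deriv y y' a b" "a \<le> c" "d \<le> b"
  shows "ac_deriv y y' c d"
  unfolding ac_deriv_def
proof (intro conjI ballI)
  show i: "y' absolutely_integrable_on {c..d}"
    using assms unfolding ac_deriv_def
    by (meson absolutely_integrable_on_subinterval atLeastatMost_subset_iff)
  fix s assume s: "s \<in> {c..d}"
  have "y' integrable_on {a..s}"
    using assms s unfolding ac_deriv_def absolutely_integrable_on_def
    by (meson atLeastAtMost_iff atLeastatMost_subset_iff integrable_on_subinterval order.refl order_trans)
  then have "integral {a..c} y' + integral {c..s} y' = integral {a..s} y'"
    using assms s by (intro Henstock_Kurzweil_Integration.integral_combine) auto
  moreover have "integral {a..s} y' = y s - y a" "integral {a..c} y' = y c - y a"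
    using assms s unfolding ac_deriv_def by auto
  ultimately show "integral {c..s} y' = y s - y c"
    by (simp add: algebra_simps)
qed

lemma ac_deriv_diff:
  assumes "ac_deriv y y' a b" "a \<le> c" "c \<le> d" "d \<le> b"
  shows "integral {c..d} y' = y d - y c"
  using ac_deriv_subinterval[OF assms(1,2,4)] assms(3) unfolding ac_deriv_def by fastforce

lemma ac_deriv_continuous:
  assumes "ac_deriv y y' a b"
  shows "continuous_on {a..b} y"
proof -
  have "continuous_on {a..b} (\<lambda>s. y a + integral {a..s} y')"
    using assms unfolding ac_deriv_def absolutely_integrable_on_def
    by (intro continuous_intros indefinite_integral_continuous_1) auto
  then show ?thesis
    by (rule continuous_on_eq) (use assms in \<open>auto simp: ac_deriv_def\<close>)
qed

text \<open>The sum of norms over the basis is continuous in time and dominates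
  \<open>onorm\<close>, so compactness of the interval yields one bound for all times.\<close>

lemma C1_derivative_bounded_on_path:
  fixes \<Phi>' :: "'a::euclidean_space \<Rightarrow> 'a \<Rightarrow> 'b::real_normed_vector"
  assumes y: "continuous_on {a..b} (y :: real \<Rightarrow> 'a)"
    and lin: "\<And>x. bounded_linear (\<Phi>' x)"
    and cont: "\<And>h. continuous_on UNIV (\<lambda>x. \<Phi>' x h)"
  obtains B where "B > 0" "\<And>s h. s \<in> {a..b} \<Longrightarrow> norm (\<Phi>' (y s) h) \<le> B * norm h"
proof -
  have "continuous_on {a..b} (\<lambda>s. \<Sum>i\<in>Basis. norm (\<Phi>' (y s) i))"
    by (intro continuous_intros continuous_on_compose2[OF cont y]) auto
  then have "bounded ((\<lambda>s. \<Sum>i\<in>Basis. norm (\<Phi>' (y s) i)) ` {a..b})"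
    by (intro compact_imp_bounded compact_continuous_image) auto
  then obtain B where B: "B > 0" "\<And>s. s \<in> {a..b} \<Longrightarrow> (\<Sum>i\<in>Basis. norm (\<Phi>' (y s) i)) \<le> B"
    unfolding bounded_pos by (force simp: image_iff)
  have "norm (\<Phi>' (y s) h) \<le> B * norm h" if "s \<in> {a..b}" for s h
  proof -
    have "norm (\<Phi>' (y s) h) \<le> onorm (\<Phi>' (y s)) * norm h"
      using lin by (rule onorm)
    also have "onorm (\<Phi>' (y s)) \<le> B"
      using onorm_componentwise[OF lin] B(2)[OF that] order_trans by blast
    finally show ?thesis by (simp add: mult_right_mono)
  qed
  with B(1) show thesis using that by blast
qed

text \<open>Riemann sums are compared with telescoping increments of \<open>\<Phi> (y s)\<close>.
  The error on a cell has two parts: the Henstock error of \<open>y'\<close>, amplified by at most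
  \<open>B\<close>, and the linearization error of \<open>\<Phi>\<close>, controlled by the integral
  of \<open>norm (y' s)\<close>. No pointwise derivative of \<open>y\<close> enters.\<close>

lemma has_integral_C1_comp_ac:
  fixes \<Phi> :: "'a::euclidean_space \<Rightarrow> 'b::euclidean_space"
  assumes deriv: "\<And>x. (\<Phi> has_derivative \<Phi>' x) (at x)"
    and cont: "\<And>h. continuous_on UNIV (\<lambda>x. \<Phi>' x h)"
    and ac: "ac_deriv y y' a b" and ab: "a \<le> b"
  shows "((\<lambda>s. \<Phi>' (y s) (y' s)) has_integral (\<Phi> (y b) - \<Phi> (y a))) {a..b}"
proof -
  have lin: "bounded_linear (\<Phi>' x)" for x
    using deriv has_derivative_bounded_linear by blast
  note yc = ac_deriv_continuous[OF ac]
  obtain B where B: "B > 0" "\<And>s h. s \<in> {a..b} \<Longrightarrow> norm (\<Phi>' (y s) h) \<le> B * norm h"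
    using C1_derivative_bounded_on_path[where y = y and a = a and b = b and \<Phi>' = \<Phi>', OF yc lin cont] by blast
  have ai: "y' absolutely_integrable_on {a..b}" using ac by (simp add: ac_deriv_def)
  then have int: "y' integrable_on {a..b}" and nint: "(\<lambda>s. norm (y' s)) integrable_on {a..b}"
    by (auto simp: absolutely_integrable_on_def)
  define V where "V = integral {a..b} (\<lambda>s. norm (y' s))"
  have V: "V \<ge> 0" unfolding V_def by (intro Henstock_Kurzweil_Integration.integral_nonneg nint) auto
  show ?thesis
    unfolding has_integral box_real[symmetric]
  proof (intro allI impI)
    fix e :: real assume e: "e > 0"
    \<comment> \<open>The linearization errors add up to at most \<open>\<eta> * V\<close>; the
      denominator \<open>V + 1\<close> keeps this below \<open>e / 2\<close> and makes
      \<open>V = 0\<close> harmless.\<close>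
    define \<eta> where "\<eta> = e / (2 * (V + 1))"
    have \<eta>: "\<eta> > 0" "\<eta> * V < e / 2" using e V by (auto simp: \<eta>_def field_simps)
    \<comment> \<open>Henstock's lemma bounds the sum of the norms of the cell errors, not just the
      norm of their sum; \<open>e / (2 * B)\<close> becomes \<open>e / 2\<close> after amplification
      by \<open>B\<close>.\<close>
    obtain \<gamma> where \<gamma>: "gauge \<gamma>"
      and \<gamma>p: "\<And>p. \<lbrakk>p tagged_partial_division_of (cbox a b); \<gamma> fine p\<rbrakk> \<Longrightarrow>
             sum (\<lambda>(x,k). norm(measure lborel k *\<^sub>R y' x - integral k y')) p < e / (2 * B)"
      using Henstock_lemma[of y' a b "e / (2 * B)"] int e B(1) by (auto simp: box_real)
    \<comment> \<open>Continuity of \<open>y\<close> sends a small interval around the tag into the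
      ball where strict differentiability at \<open>y x\<close> applies. Outside
      \<open>{a..b}\<close> a dummy radius 1 completes the gauge.\<close>
    have "\<exists>d>0. x \<in> {a..b} \<longrightarrow> (\<forall>u\<in>{a..b}. \<forall>v\<in>{a..b}. u \<in> ball x d \<longrightarrow> v \<in> ball x d \<longrightarrow>
        norm (\<Phi> (y v) - \<Phi> (y u) - \<Phi>' (y x) (y v - y u)) \<le> \<eta> * norm (y v - y u))" for x
    proof (cases "x \<in> {a..b}")
      case True
      obtain r where r: "r > 0"
        "\<And>z w. z \<in> ball (y x) r \<Longrightarrow> w \<in> ball (y x) r \<Longrightarrow>
          norm (\<Phi> z - \<Phi> w - \<Phi>' (y x) (z - w)) \<le> \<eta> * norm (z - w)"
        using C1_strict_derivative[where \<Phi> = \<Phi> and \<Phi>' = \<Phi>' and x = "y x", OF deriv cont \<eta>(1)] by blast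
      from yc True r(1) obtain d where d: "d > 0"
        "\<And>u. u \<in> {a..b} \<Longrightarrow> dist u x < d \<Longrightarrow> dist (y u) (y x) < r"
        unfolding continuous_on_iff by blast
      show ?thesis
        using d r(2) by (intro exI[of _ d]) (auto simp: dist_commute)
    qed (auto intro: exI[of _ 1])
    then obtain d where d: "\<And>x. d x > 0" and dd: "\<And>x u v. x \<in> {a..b} \<Longrightarrow> u \<in> {a..b} \<Longrightarrow> v \<in> {a..b} \<Longrightarrow>
        u \<in> ball x (d x) \<Longrightarrow> v \<in> ball x (d x) \<Longrightarrow>
        norm (\<Phi> (y v) - \<Phi> (y u) - \<Phi>' (y x) (y v - y u)) \<le> \<eta> * norm (y v - y u)"
      by metis
    show "\<exists>\<gamma>. gauge \<gamma> \<and> (\<forall>p. p tagged_division_of cbox a b \<and> \<gamma> fine p \<longrightarrow>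
       norm ((\<Sum>(x, k)\<in>p. measure lborel k *\<^sub>R \<Phi>' (y x) (y' x)) - (\<Phi> (y b) - \<Phi> (y a))) < e)"
    proof (intro exI[of _ "\<lambda>x. \<gamma> x \<inter> ball x (d x)"] conjI allI impI; (elim conjE)?)
      show "gauge (\<lambda>x. \<gamma> x \<inter> ball x (d x))"
        using \<gamma> d by (intro gauge_Int) (auto intro: gauge_ball_dependent)
      fix p assume p: "p tagged_division_of cbox a b" and fine: "(\<lambda>x. \<gamma> x \<inter> ball x (d x)) fine p"
      then have f1: "\<gamma> fine p" and f2: "(\<lambda>x. ball x (d x)) fine p" by (auto simp: fine_Int)
      have tel: "(\<Sum>(x,K)\<in>p. \<Phi> (y (Sup K)) - \<Phi> (y (Inf K))) = \<Phi> (y b) - \<Phi> (y a)"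
        using additive_tagged_division_1[OF ab, of p "\<lambda>s. \<Phi> (y s)"] p by (simp add: box_real)
      have "norm (\<Sum>(x,K)\<in>p. measure lborel K *\<^sub>R \<Phi>' (y x) (y' x) - (\<Phi> (y (Sup K)) - \<Phi> (y (Inf K))))
        \<le> (\<Sum>(x,K)\<in>p. B * norm (measure lborel K *\<^sub>R y' x - integral K y') + \<eta> * integral K (\<lambda>s. norm (y' s)))"
      proof (rule sum_norm_le, clarify)
        fix x K assume xK: "(x, K) \<in> p"
        then obtain u v where K: "K = {u..v}" using tagged_division_ofD(4)[OF p xK] by (auto simp: box_real)
        have sub: "K \<subseteq> {a..b}" and x: "x \<in> K" using p xK by (auto simp: box_real)
        then have uv: "a \<le> u" "u \<le> v" "v \<le> b" by (auto simp: K)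
        have bK: "K \<subseteq> ball x (d x)" using f2 xK by (auto simp: fine_def)
        have SI: "Sup K = v" "Inf K = u" using uv by (auto simp: K)
        have dy: "y v - y u = integral K y'" using ac_deriv_diff[OF ac, of u v] uv by (simp add: K)
        have x': "x \<in> {a..b}" using sub x by blast
        have "norm (integral K y') \<le> integral K (\<lambda>s. norm (y' s))"
          unfolding K using uv int nint
          by (intro Henstock_Kurzweil_Integration.integral_norm_bound_integral)
            (auto intro: integrable_on_subinterval)
        moreover have "norm (\<Phi> (y v) - \<Phi> (y u) - \<Phi>' (y x) (y v - y u)) \<le> \<eta> * norm (y v - y u)"
          using uv bK x' by (intro dd) (auto simp: K)
        ultimately have 1: "norm (\<Phi> (y v) - \<Phi> (y u) - \<Phi>' (y x) (integral K y')) \<le> \<eta> * integral K (\<lambda>s. norm (y' s))"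
          using mult_left_mono[of _ _ \<eta>] \<eta>(1) unfolding dy by (meson less_imp_le order_trans)
        have 2: "norm (\<Phi>' (y x) (measure lborel K *\<^sub>R y' x - integral K y')) \<le> B * norm (measure lborel K *\<^sub>R y' x - integral K y')"
          using B(2)[OF x'] .
        interpret L: bounded_linear "\<Phi>' (y x)" by (rule lin)
        \<comment> \<open>Linearity of \<open>\<Phi>' (y x)\<close> splits the cell error into
          exactly the two parts bounded in \<open>2\<close> and \<open>1\<close>.\<close>
        have "measure lborel K *\<^sub>R \<Phi>' (y x) (y' x) - (\<Phi> (y v) - \<Phi> (y u)) =
           \<Phi>' (y x) (measure lborel K *\<^sub>R y' x - integral K y') - (\<Phi> (y v) - \<Phi> (y u) - \<Phi>' (y x) (integral K y'))"
          unfolding L.diff L.scaleR by (simp only: diff_diff_eq2 diff_add_cancel)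
        then show "norm (measure lborel K *\<^sub>R \<Phi>' (y x) (y' x) - (\<Phi> (y (Sup K)) - \<Phi> (y (Inf K))))
          \<le> B * norm (measure lborel K *\<^sub>R y' x - integral K y') + \<eta> * integral K (\<lambda>s. norm (y' s))"
          unfolding SI using order_trans[OF norm_triangle_ineq4 add_mono[OF 2 1]] by (simp only:)
      qed
      also have "\<dots> = B * (\<Sum>(x,K)\<in>p. norm (measure lborel K *\<^sub>R y' x - integral K y')) + \<eta> * (\<Sum>(x,K)\<in>p. integral K (\<lambda>s. norm (y' s)))"
        by (simp add: sum.distrib sum_distrib_left case_prod_unfold)
      also have "(\<Sum>(x,K)\<in>p. integral K (\<lambda>s. norm (y' s))) = V"
        using integral_combine_tagged_division_topdown[of "\<lambda>s. norm (y' s)" a b p] nint p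
        by (simp add: V_def box_real)
      also have "B * (\<Sum>(x,K)\<in>p. norm (measure lborel K *\<^sub>R y' x - integral K y')) + \<eta> * V < B * (e / (2 * B)) + e / 2"
        using \<gamma>p[OF _ f1] p \<eta>(2) B(1)
        by (intro add_strict_mono mult_strict_left_mono) (auto simp: tagged_division_of_def)
      also have "\<dots> = e" using B(1) by simp
      finally show "norm ((\<Sum>(x, k)\<in>p. measure lborel k *\<^sub>R \<Phi>' (y x) (y' x)) - (\<Phi> (y b) - \<Phi> (y a))) < e"
        unfolding tel[symmetric] sum_subtractf[symmetric] case_prod_unfold .
    qed
  qed
qed

text \<open>The chain rule on each \<open>{a..s}\<close> supplies the integrals; domination by
  \<open>B * norm (y' s)\<close> makes the integrability absolute.\<close>

lemma ac_deriv_C1_comp: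
  fixes \<Phi> :: "'a::euclidean_space \<Rightarrow> 'b::euclidean_space"
  assumes deriv: "\<And>x. (\<Phi> has_derivative \<Phi>' x) (at x)"
    and cont: "\<And>h. continuous_on UNIV (\<lambda>x. \<Phi>' x h)"
    and ac: "ac_deriv y y' a b"
  shows "ac_deriv (\<lambda>s. \<Phi> (y s)) (\<lambda>s. \<Phi>' (y s) (y' s)) a b"
proof (cases "a \<le> b")
  case True
  have hi: "((\<lambda>s. \<Phi>' (y s) (y' s)) has_integral (\<Phi> (y s) - \<Phi> (y a))) {a..s}" if "s \<in> {a..b}" for s
    using has_integral_C1_comp_ac[where \<Phi> = \<Phi> and \<Phi>' = \<Phi>', OF deriv cont ac_deriv_subinterval[OF ac order_refl]] that by simp
  have lin: "bounded_linear (\<Phi>' x)" for x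
    using deriv has_derivative_bounded_linear by blast
  obtain B where B: "B > 0" "\<And>s h. s \<in> {a..b} \<Longrightarrow> norm (\<Phi>' (y s) h) \<le> B * norm h"
    using C1_derivative_bounded_on_path[where y = y and a = a and b = b and \<Phi>' = \<Phi>', OF ac_deriv_continuous[OF ac] lin cont] by blast
  have "(\<lambda>s. \<Phi>' (y s) (y' s)) absolutely_integrable_on {a..b}"
  proof (rule absolutely_integrable_integrable_bound)
    show "norm (\<Phi>' (y s) (y' s)) \<le> B * norm (y' s)" if "s \<in> {a..b}" for s
      using B(2)[OF that] .
    show "(\<lambda>s. \<Phi>' (y s) (y' s)) integrable_on {a..b}"
      using hi[of b] True by (auto simp: integrable_on_def)
    show "(\<lambda>s. B * norm (y' s)) integrable_on {a..b}"
      using ac by (intro integrable_on_mult_right) (auto simp: ac_deriv_def absolutely_integrable_on_def)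
  qed
  then show ?thesis
    unfolding ac_deriv_def using integral_unique[OF hi] by blast
next
  \<comment> \<open>\<open>ac_deriv\<close> does not presuppose \<open>a \<le> b\<close>; over an
    empty interval both conditions are trivial.\<close>
  case False
  then have "{a..b} = {}" by simp
  show ?thesis
    unfolding ac_deriv_def \<open>{a..b} = {}\<close>
    by (intro conjI absolutely_integrable_negligible negligible_empty) blast
qed

section \<open>Functions vanishing almost everywhere\<close>

text \<open>Nonnegativity turns gauge integrability into Lebesgue integrability, where a zero
  integral forces the function to vanish almost everywhere.\<close>

lemma AE_has_integral_0_nonneg:
  fixes f :: "real \<Rightarrow> real"
  assumes "(f has_integral 0) {a..b}" "\<And>s. s \<in> {a..b} \<Longrightarrow> f s \<ge> 0"
  shows "AE s in lborel. s \<in> {a..b} \<longrightarrow> f s = 0"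
proof -
  have ai: "f absolutely_integrable_on {a..b}"
    using assms by (subst absolutely_integrable_on_iff_nonneg) (auto simp: integrable_on_def)
  have "(LINT s:{a..b}|lebesgue. f s) = 0"
    using set_lebesgue_integral_eq_integral(2)[OF ai] integral_unique[OF assms(1)] by simp
  then have "AE s in lebesgue. indicat_real {a..b} s *\<^sub>R f s = 0"
    using ai assms(2) unfolding set_lebesgue_integral_def set_integrable_def
    by (subst (asm) integral_nonneg_eq_0_iff_AE) (auto simp: indicator_def)
  then have "AE s in lebesgue. s \<in> {a..b} \<longrightarrow> f s = 0"
    by (rule AE_mp) (auto simp: indicator_def)
  then show ?thesis by (simp add: AE_completion_iff)
qed

text \<open>When all cell integrals are zero, Henstock's lemma bounds the Riemann sums of
  \<open>norm (f s)\<close> themselves. The norm then has integral zero, which reduces the claim to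
  the nonnegative case.\<close>

lemma AE_zero_if_integrals_zero:
  fixes f :: "real \<Rightarrow> 'a::euclidean_space"
  assumes "\<And>s. s \<in> {a..b} \<Longrightarrow> (f has_integral 0) {a..s}"
  shows "AE s in lborel. s \<in> {a..b} \<longrightarrow> f s = 0"
proof (cases "a \<le> b")
  case True
  have int: "f integrable_on {a..b}" using assms[of b] True by (auto simp: integrable_on_def)
  \<comment> \<open>The hypothesis covers intervals starting at \<open>a\<close>; differences reach
    every cell.\<close>
  have z: "integral {u..v} f = 0" if "a \<le> u" "u \<le> v" "v \<le> b" for u v
  proof -
    have "integral {a..u} f + integral {u..v} f = integral {a..v} f"
      using that int by (intro Henstock_Kurzweil_Integration.integral_combine) (auto intro: integrable_on_subinterval)
    moreover have "integral {a..u} f = 0" "integral {a..v} f = 0"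
      using that assms by (auto intro!: integral_unique)
    ultimately show ?thesis by simp
  qed
  have "((\<lambda>s. norm (f s)) has_integral 0) {a..b}"
    unfolding has_integral box_real[symmetric]
  proof (intro allI impI)
    fix e :: real assume "e > 0"
    then obtain \<gamma> where \<gamma>: "gauge \<gamma>"
      and \<gamma>p: "\<And>p. \<lbrakk>p tagged_partial_division_of (cbox a b); \<gamma> fine p\<rbrakk> \<Longrightarrow>
             sum (\<lambda>(x,k). norm(measure lborel k *\<^sub>R f x - integral k f)) p < e"
      using Henstock_lemma[of f a b e] int by (auto simp: box_real)
    show "\<exists>\<gamma>. gauge \<gamma> \<and> (\<forall>p. p tagged_division_of cbox a b \<and> \<gamma> fine p \<longrightarrow>
       norm ((\<Sum>(x, k)\<in>p. measure lborel k *\<^sub>R norm (f x)) - 0) < e)"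
    proof (intro exI[of _ \<gamma>] conjI allI impI \<gamma>; elim conjE)
      fix p assume p: "p tagged_division_of cbox a b" and fine: "\<gamma> fine p"
      have "(\<Sum>(x, k)\<in>p. measure lborel k *\<^sub>R norm (f x)) = (\<Sum>(x,k)\<in>p. norm(measure lborel k *\<^sub>R f x - integral k f))"
      proof (rule sum.cong[OF refl], clarify)
        fix x K assume xK: "(x, K) \<in> p"
        then obtain u v where K: "K = {u..v}" using tagged_division_ofD(4)[OF p xK] by (auto simp: box_real)
        have "K \<subseteq> {a..b}" "x \<in> K" using p xK by (auto simp: box_real)
        then have "a \<le> u" "u \<le> v" "v \<le> b" by (auto simp: K)
        then show "measure lborel K *\<^sub>R norm (f x) = norm (measure lborel K *\<^sub>R f x - integral K f)"
          using z by (simp add: K)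
      qed
      also have "\<dots> < e" using \<gamma>p fine p by (auto simp: tagged_division_of_def)
      finally show "norm ((\<Sum>(x, k)\<in>p. measure lborel k *\<^sub>R norm (f x)) - 0) < e"
        by (simp add: sum_nonneg case_prod_unfold)
    qed
  qed
  then show ?thesis using AE_has_integral_0_nonneg[of "\<lambda>s. norm (f s)" a b] by simp
qed simp

text \<open>With \<open>\<Phi>\<^sub>n x = arctan (n x) / n\<close> we have \<open>\<Phi>\<^sub>n \<rightarrow> 0\<close> uniformly, while \<open>\<Phi>\<^sub>n'\<close> tends boundedly
  to the indicator of \<open>{0}\<close>. Passing to the limit in the chain rule shows that the integral of
  \<open>p\<close> over the zeros of \<open>k\<close> vanishes on every interval; no differentiation theorem for
  integrals is needed.\<close>
lemma ac_deriv_zero_on_zeros: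
  fixes k :: "real \<Rightarrow> real"
  assumes ac: "ac_deriv k p a b"
  shows "AE s in lborel. s \<in> {a..b} \<longrightarrow> k s = 0 \<longrightarrow> p s = 0"
proof -
  \<comment> \<open>\<open>Suc n\<close> runs through the positive integers, so the denominator
    never vanishes.\<close>
  define \<Phi> where "\<Phi> n x = arctan (real (Suc n) * x) / real (Suc n)" for n x
  define \<Phi>' where "\<Phi>' n x h = h / (1 + (real (Suc n) * x)\<^sup>2)" for n x h
  define q where "q s = (if k s = 0 then p s else 0)" for s
  have deriv: "(\<Phi> n has_derivative \<Phi>' n x) (at x)" for n x
  proof -
    have "((\<lambda>x. arctan (c * x) / c) has_derivative (\<lambda>h. h / (1 + (c * x)\<^sup>2))) (at x)"
      if "c \<noteq> 0" for c :: real
      using that by (auto intro!: derivative_eq_intros simp: divide_inverse mult_ac)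
    then show ?thesis
      unfolding \<Phi>_def \<Phi>'_def by simp
  qed
  have cont: "continuous_on UNIV (\<lambda>x. \<Phi>' n x h)" for n h
    unfolding \<Phi>'_def by (intro continuous_intros) (auto simp: add_nonneg_eq_0_iff)
  have "(q has_integral 0) {a..s}" if s: "s \<in> {a..b}" for s
  proof (rule has_integral_dominated_convergence[where h = "\<lambda>t. \<bar>p t\<bar>"
        and f = "\<lambda>n t. \<Phi>' n (k t) (p t)" and y = "\<lambda>n. \<Phi> n (k s) - \<Phi> n (k a)"])
    have as: "ac_deriv k p a s" using ac_deriv_subinterval[OF ac] s by simp
    show "((\<lambda>t. \<Phi>' n (k t) (p t)) has_integral \<Phi> n (k s) - \<Phi> n (k a)) {a..s}" for n
      using has_integral_C1_comp_ac[OF deriv cont as] s by simp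
    show "(\<lambda>t. \<bar>p t\<bar>) integrable_on {a..s}"
      using as by (simp add: ac_deriv_def absolutely_integrable_on_def)
    show "\<forall>t\<in>{a..s}. norm (\<Phi>' n (k t) (p t)) \<le> \<bar>p t\<bar>" for n
    proof
      fix t
      have "norm (x / (1 + z\<^sup>2)) \<le> \<bar>x\<bar>" for x z :: real
      proof -
        have "0 < 1 + z\<^sup>2" by (rule add_pos_nonneg) auto
        moreover have "\<bar>x\<bar> \<le> \<bar>x\<bar> * (1 + z\<^sup>2)" unfolding distrib_left by simp
        ultimately show ?thesis
          unfolding real_norm_def abs_divide by (simp only: abs_of_pos mult_imp_div_pos_le)
      qed
      then show "norm (\<Phi>' n (k t) (p t)) \<le> \<bar>p t\<bar>"
        unfolding \<Phi>'_def .
    qed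
    show "\<forall>t\<in>{a..s}. (\<lambda>n. \<Phi>' n (k t) (p t)) \<longlonglongrightarrow> q t"
    proof
      fix t
      show "(\<lambda>n. \<Phi>' n (k t) (p t)) \<longlonglongrightarrow> q t"
      proof (cases "k t = 0")
        case False
        have "filterlim (\<lambda>n. real (Suc n)) at_top sequentially"
          by (rule filterlim_compose[OF filterlim_real_sequentially filterlim_Suc])
        then have "filterlim (\<lambda>n. (k t)\<^sup>2 * (real (Suc n))\<^sup>2) at_top sequentially"
          using False by (intro filterlim_tendsto_pos_mult_at_top[OF tendsto_const] filterlim_pow_at_top) auto
        then have "filterlim (\<lambda>n. 1 + (k t)\<^sup>2 * (real (Suc n))\<^sup>2) at_top sequentially"
          by (intro filterlim_tendsto_add_at_top[OF tendsto_const])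
        then have "(\<lambda>n. p t / (1 + (k t)\<^sup>2 * (real (Suc n))\<^sup>2)) \<longlonglongrightarrow> 0"
          by (intro real_tendsto_divide_at_top[OF tendsto_const])
        then show ?thesis using False by (simp add: \<Phi>'_def q_def power_mult_distrib mult.commute)
      qed (simp add: \<Phi>'_def q_def)
    qed
    \<comment> \<open>The boundary terms disappear in the limit because \<open>arctan\<close> is
      bounded by \<open>pi / 2\<close>.\<close>
    have "(\<lambda>n. \<Phi> n x) \<longlonglongrightarrow> 0" for x
    proof (rule Lim_null_comparison[where g = "\<lambda>n. (pi / 2) / real (Suc n)"])
      show "eventually (\<lambda>n. norm (\<Phi> n x) \<le> (pi / 2) / real (Suc n)) sequentially"
      proof (intro always_eventually allI)
        fix n
        have "\<bar>arctan (real (Suc n) * x)\<bar> \<le> pi / 2"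
          using arctan_bounded[of "real (Suc n) * x"] by linarith
        then show "norm (\<Phi> n x) \<le> (pi / 2) / real (Suc n)"
          unfolding \<Phi>_def real_norm_def abs_divide by (simp only: abs_of_nat divide_right_mono of_nat_0_le_iff)
      qed
      show "(\<lambda>n. (pi / 2) / real (Suc n)) \<longlonglongrightarrow> 0"
        by (rule LIMSEQ_Suc[OF lim_const_over_n])
    qed
    then show "(\<lambda>n. \<Phi> n (k s) - \<Phi> n (k a)) \<longlonglongrightarrow> 0"
      using tendsto_diff by fastforce
  qed
  then have "AE s in lborel. s \<in> {a..b} \<longrightarrow> q s = 0"
    by (rule AE_zero_if_integrals_zero)
  then show ?thesis by (rule AE_mp) (auto simp: q_def)
qed

section \<open>Sign control and persistence of contact\<close>

text \<open>If \<open>h s\<close> were positive, then after the last time \<open>t\<close> before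
  \<open>s\<close> with \<open>h t \<le> 0\<close> the function would stay positive with derivative
  nonpositive almost everywhere, forcing \<open>h s \<le> h t \<le> 0\<close>.\<close>

lemma ac_deriv_nonpos:
  fixes h :: "real \<Rightarrow> real"
  assumes ac: "ac_deriv h p a b" and init: "h a \<le> 0"
    and AE: "AE s in lborel. s \<in> {a..b} \<longrightarrow> h s > 0 \<longrightarrow> p s \<le> 0"
    and s: "s \<in> {a..b}"
  shows "h s \<le> 0"
proof (rule ccontr)
  assume pos: "\<not> h s \<le> 0"
  let ?Z = "{t \<in> {a..s}. h t \<le> 0}"
  have "continuous_on {a..s} h"
    using ac_deriv_continuous[OF ac] s continuous_on_subset by fastforce
  then have "closed ?Z"
    by (intro continuous_on_closed_Collect_le continuous_intros) auto
  moreover have "bounded ?Z"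
    by (rule bounded_subset[OF bounded_closed_interval[of a s]]) auto
  ultimately have "compact ?Z"
    by (simp add: compact_eq_bounded_closed)
  then obtain t where t: "t \<in> ?Z" and max: "\<And>r. r \<in> ?Z \<Longrightarrow> r \<le> t"
    using compact_attains_sup[of ?Z] init s by fastforce
  from AE obtain N where N: "N \<in> null_sets lborel" "\<And>r. r \<notin> N \<Longrightarrow> r \<in> {a..b} \<Longrightarrow> h r > 0 \<Longrightarrow> p r \<le> 0"
    by (auto elim!: AE_E3)
  have int: "p integrable_on {t..s}"
    using ac_deriv_subinterval[OF ac, of t s] t s by (auto simp: ac_deriv_def absolutely_integrable_on_def)
  have "integral {t..s} p \<le> 0"
  proof -
    \<comment> \<open>At \<open>t\<close> itself \<open>h\<close> is not positive, so
      \<open>t\<close> joins the exceptional null set.\<close>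
    have neg: "negligible (insert t N)"
      using N(1) by (simp add: negligible_iff_null_sets null_sets_completionI)
    have "integral {t..s} p = integral {t..s} (\<lambda>r. if r \<in> insert t N then 0 else p r)"
      by (rule integral_spike[OF neg]) auto
    also have "\<dots> \<le> 0"
    proof -
      have "(\<lambda>r. if r \<in> insert t N then 0 else p r) integrable_on {t..s}"
        using int by (rule integrable_spike[OF _ neg]) auto
      moreover have "(if r \<in> insert t N then 0 else p r) \<le> 0" if r: "r \<in> {t..s}" for r
      proof (cases "r \<in> insert t N")
        case False
        then have "h r > 0" using max[of r] r t by force
        then show ?thesis using N(2)[of r] False r t s by auto
      qed simp
      ultimately have "integral {t..s} (\<lambda>r. if r \<in> insert t N then 0 else p r) \<le> integral {t..s} (\<lambda>r. 0)"
        by (intro integral_le integrable_0)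
      then show ?thesis by (simp only: integral_0)
    qed
    finally show ?thesis .
  qed
  moreover have "integral {t..s} p = h s - h t"
    using ac_deriv_diff[OF ac] t s by auto
  ultimately show False using pos t by auto
qed

text \<open>Lets \<open>ac_deriv_nonpos\<close> yield lower bounds as well.\<close>

lemma ac_deriv_uminus:
  assumes "ac_deriv h p a b"
  shows "ac_deriv (\<lambda>s. - h s) (\<lambda>s. - p s) a b"
  by (rule ac_deriv_C1_comp[where \<Phi> = uminus and \<Phi>' = "\<lambda>_ h. - h"])
    (auto intro!: derivative_eq_intros assms)

text \<open>\<open>h\<close> cannot become positive because there \<open>\<theta> = 1\<close> and \<open>h' = \<phi> \<le> 0\<close>; hence \<open>g\<close> never
  becomes positive. Where \<open>h < 0\<close>, also \<open>\<theta> = 0\<close> almost everywhere: for \<open>g < 0\<close> by assumption,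
  and on \<open>g = 0\<close> because there \<open>0 = g' = \<theta> h\<close>. So \<open>h' = d \<ge> 0\<close> and \<open>h\<close> cannot become negative.\<close>
lemma persistent_contact:
  fixes g h :: "real \<Rightarrow> real"
  assumes g: "ac_deriv g pg a b" and h: "ac_deriv h ph a b" and init: "g a = 0" "h a = 0"
    and \<phi>: "\<And>s. s \<in> {a..b} \<Longrightarrow> \<phi> s \<le> 0" and d: "\<And>s. s \<in> {a..b} \<Longrightarrow> d s \<ge> 0"
    and dyn: "AE s in lborel. s \<in> {a..b} \<longrightarrow> (\<exists>\<theta>\<ge>0. \<theta> \<le> 1 \<and> pg s = \<theta> * h s \<and>
       ph s = \<theta> * \<phi> s + (1 - \<theta>) * d s \<and> (h s > 0 \<longrightarrow> \<theta> = 1) \<and> (g s < 0 \<longrightarrow> h s < 0 \<longrightarrow> \<theta> = 0))"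
    and s: "s \<in> {a..b}"
  shows "g s = 0 \<and> h s = 0"
proof -
  have h_le: "h s \<le> 0" if "s \<in> {a..b}" for s
    using h _ _ that
  proof (rule ac_deriv_nonpos)
    show "AE s in lborel. s \<in> {a..b} \<longrightarrow> h s > 0 \<longrightarrow> ph s \<le> 0"
      using dyn by (rule AE_mp) (use \<phi> in auto)
  qed (use init in simp)
  have g_le: "g s \<le> 0" if "s \<in> {a..b}" for s
    using g _ _ that
  proof (rule ac_deriv_nonpos)
    show "AE s in lborel. s \<in> {a..b} \<longrightarrow> g s > 0 \<longrightarrow> pg s \<le> 0"
      using dyn by (rule AE_mp) (use h_le in \<open>auto simp: mult_nonneg_nonpos\<close>)
  qed (use init in simp)
  have h_ge: "- h s \<le> 0" if "s \<in> {a..b}" for s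
    using ac_deriv_uminus[OF h] _ _ that
  proof (rule ac_deriv_nonpos)
    show "AE s in lborel. s \<in> {a..b} \<longrightarrow> - h s > 0 \<longrightarrow> - ph s \<le> 0"
      using dyn ac_deriv_zero_on_zeros[OF g]
    proof eventually_elim
      case (elim s)
      show ?case
      proof (intro impI)
        assume s: "s \<in> {a..b}" and neg: "- h s > 0"
        with elim obtain \<theta> where \<theta>: "pg s = \<theta> * h s" "ph s = \<theta> * \<phi> s + (1 - \<theta>) * d s"
          "g s < 0 \<longrightarrow> \<theta> = 0" by auto
        have "\<theta> = 0"
        proof (cases "g s = 0")
          case True
          with elim s have "pg s = 0" by blast
          with \<theta>(1) neg show ?thesis by simp
        qed (use g_le[OF s] \<theta>(3) in simp)
        then show "- ph s \<le> 0" using \<theta>(2) d[OF s] by simp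
      qed
    qed
  qed (use init in simp)
  \<comment> \<open>By now \<open>h\<close> is zero throughout, so \<open>pg = \<theta> * h\<close>
    vanishes and \<open>g\<close> cannot become negative either.\<close>
  have "- g s \<le> 0" if "s \<in> {a..b}" for s
    using ac_deriv_uminus[OF g] _ _ that
  proof (rule ac_deriv_nonpos)
    show "AE s in lborel. s \<in> {a..b} \<longrightarrow> - g s > 0 \<longrightarrow> - pg s \<le> 0"
      using dyn by (rule AE_mp) (use h_le h_ge in \<open>fastforce intro!: AE_I2\<close>)
  qed (use init in simp)
  with h_le h_ge g_le s show ?thesis by force
qed

subsection \<open>Linear algebra and derivatives of the switching functions\<close>

text \<open>Positive definiteness leaves a trivial kernel, so the square matrix is invertible and
  the choice made by \<open>matrix_inv\<close> is a genuine inverse.\<close>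

lemma pd_matrix_inv_mult:
  fixes A :: "real^'n^'n"
  assumes pd: "\<And>x. x \<noteq> 0 \<Longrightarrow> x \<bullet> (A *v x) > 0"
  shows "A *v (matrix_inv A *v x) = x"
proof -
  have "x = 0" if "A *v x = 0" for x
    using pd[of x] that by force
  then have "invertible A"
    using matrix_left_invertible_ker[of A] invertible_left_inverse by blast
  then have "A ** matrix_inv A = mat 1"
    unfolding invertible_def matrix_inv_def by (rule someI2_ex) blast
  then show ?thesis
    by (simp add: matrix_vector_mul_assoc)
qed

text \<open>With \<open>w = matrix_inv A *v x\<close> the quantity equals
  \<open>w \<bullet> (A *v w)\<close>.\<close>

lemma pd_matrix_inv_pos:
  fixes A :: "real^'n^'n"
  assumes pd: "\<And>x. x \<noteq> 0 \<Longrightarrow> x \<bullet> (A *v x) > 0" and x: "x \<noteq> 0"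
  shows "x \<bullet> (matrix_inv A *v x) > 0"
proof -
  have eq: "A *v (matrix_inv A *v x) = x" by (rule pd_matrix_inv_mult[OF pd])
  then have "matrix_inv A *v x \<noteq> 0" using x by auto
  from pd[OF this] show ?thesis by (simp add: eq inner_commute)
qed

text \<open>Serves to reverse the orthogonality assumption, which has \<open>b\<close> on the left,
  while the normal acceleration needs \<open>grad fc\<close> there.\<close>

lemma symmetric_matrix_inv_inner:
  fixes A :: "real^'n^'n"
  assumes pd: "\<And>x. x \<noteq> 0 \<Longrightarrow> x \<bullet> (A *v x) > 0" and sym: "transpose A = A"
  shows "x \<bullet> (matrix_inv A *v z) = z \<bullet> (matrix_inv A *v x)"
proof -
  have self: "v \<bullet> (A *v w) = (A *v v) \<bullet> w" for v w
    using dot_lmul_matrix[of v A w] sym by (metis transpose_matrix_vector)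
  have "x \<bullet> (matrix_inv A *v z) = (A *v (matrix_inv A *v x)) \<bullet> (matrix_inv A *v z)"
    by (simp add: pd_matrix_inv_mult[OF pd])
  also have "\<dots> = (matrix_inv A *v x) \<bullet> (A *v (matrix_inv A *v z))"
    by (rule self[symmetric])
  also have "\<dots> = (matrix_inv A *v x) \<bullet> z"
    by (simp add: pd_matrix_inv_mult[OF pd])
  finally show ?thesis by (simp add: inner_commute)
qed

lemma C1_fun_has_derivative:
  assumes "C1_fun f"
  shows "(f has_derivative frechet_derivative f (at x)) (at x)"
  using assms by (simp add: C1_fun_def frechet_derivative_works)

lemma C1_fun_continuous: "C1_fun f \<Longrightarrow> continuous_on UNIV f"
  by (auto simp: C1_fun_def intro!: differentiable_imp_continuous_on differentiable_at_imp_differentiable_on)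

lemma C1_funI:
  assumes "\<And>x. (f has_derivative f' x) (at x)" "\<And>h. continuous_on UNIV (\<lambda>x. f' x h)"
  shows "C1_fun f"
  using assms frechet_derivative_at[OF assms(1), symmetric]
  by (auto simp: C1_fun_def differentiable_def)

text \<open>Each component of the gradient is a directional derivative of \<open>fc\<close>, hence
  C1.\<close>

lemma C2_fun_C1_grad:
  assumes "C2_fun (fc :: real^'n \<Rightarrow> real)"
  shows "C1_fun (grad fc)"
proof (rule C1_funI)
  let ?d = "\<lambda>i q. frechet_derivative fc (at q) (axis i 1)"
  have C: "C1_fun (?d i)" for i
    using assms by (simp add: C2_fun_def)
  show "(grad fc has_derivative (\<lambda>h. \<chi> i. frechet_derivative (?d i) (at x) h)) (at x)" for x
    unfolding grad_def[abs_def]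
    by (subst has_derivative_componentwise_within)
      (auto simp: Basis_vec_def inner_axis intro!: C1_fun_has_derivative[OF C])
  show "continuous_on UNIV (\<lambda>x. \<chi> i. frechet_derivative (?d i) (at x) h)" for h
    using C by (intro continuous_intros) (simp add: C1_fun_def)
qed

lemma frechet_derivative_grad:
  assumes "fc differentiable (at (q :: real^'n))"
  shows "frechet_derivative fc (at q) h = grad fc q \<bullet> h"
proof -
  have lin: "linear (frechet_derivative fc (at q))"
    using assms by (rule linear_frechet_derivative)
  have "frechet_derivative fc (at q) h = frechet_derivative fc (at q) (\<Sum>i\<in>UNIV. h $ i *\<^sub>R axis i 1)"
    using basis_expansion[of h] by (simp add: scalar_mult_eq_scaleR)
  also have "\<dots> = (\<Sum>i\<in>UNIV. h $ i * frechet_derivative fc (at q) (axis i 1))"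
    using lin by (simp add: linear_sum linear_scale o_def)
  also have "\<dots> = grad fc q \<bullet> h"
    by (simp add: inner_vec_def grad_def mult.commute)
  finally show ?thesis .
qed

text \<open>In \<open>dirterm\<close> the vector \<open>v\<close> is frozen inside the inner
  product, so only \<open>g\<close> is differentiated; this is the term that the product rule for
  \<open>g q \<bullet> v\<close> produces when \<open>q\<close> moves with velocity
  \<open>v\<close>.\<close>

lemma dirterm_eq:
  assumes "C1_fun g"
  shows "dirterm g q v = frechet_derivative g (at q) v \<bullet> v"
proof -
  have "((\<lambda>p. g p \<bullet> v) has_derivative (\<lambda>h. frechet_derivative g (at q) h \<bullet> v)) (at q)"
    by (intro has_derivative_inner_left C1_fun_has_derivative assms)
  then show ?thesis
    unfolding dirterm_def by (metis frechet_derivative_at)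
qed

lemma has_derivative_c1:
  assumes "C1_fun (fc :: real^'n \<Rightarrow> real)"
  shows "(c1 fc has_derivative (\<lambda>h. grad fc (fst (fst y)) \<bullet> fst (fst h))) (at y)"
proof -
  have "(fc has_derivative (\<lambda>h. grad fc q \<bullet> h)) (at q)" for q
    using C1_fun_has_derivative[OF assms, of q] assms frechet_derivative_grad[of fc q]
    by (simp add: C1_fun_def) (metis (no_types, lifting) ext)
  then show ?thesis
    unfolding c1_def[abs_def]
    by (rule has_derivative_compose[of "\<lambda>y. fst (fst y)", rotated]) (intro derivative_intros)
qed

text \<open>Stated for general \<open>g\<close> to cover \<open>c2\<close> (with
  \<open>grad fc\<close>) and \<open>c3\<close> (with \<open>b\<close>) at once.\<close>

lemma has_derivative_velocity:
  fixes g :: "real^'n \<Rightarrow> real^'n"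
  assumes "C1_fun g"
  shows "((\<lambda>y. g (fst (fst y)) \<bullet> snd (fst y)) has_derivative
     (\<lambda>h. g (fst (fst y)) \<bullet> snd (fst h) +
          frechet_derivative g (at (fst (fst y))) (fst (fst h)) \<bullet> snd (fst y))) (at (y :: 'n tfstate))"
proof -
  have "((\<lambda>y. g (fst (fst y))) has_derivative
     (\<lambda>h. frechet_derivative g (at (fst (fst y))) (fst (fst h)))) (at y)"
    by (rule has_derivative_compose[of "\<lambda>y. fst (fst y)", OF _ C1_fun_has_derivative[OF assms]])
      (intro derivative_intros)
  then show ?thesis by (intro has_derivative_inner derivative_intros)
qed

lemma continuous_velocity_derivative:
  fixes g :: "real^'n \<Rightarrow> real^'n"
  assumes "C1_fun g"
  shows "continuous_on UNIV (\<lambda>y :: 'n tfstate. g (fst (fst y)) \<bullet> snd (fst h) +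
          frechet_derivative g (at (fst (fst y))) (fst (fst h)) \<bullet> snd (fst y))"
proof -
  have "continuous_on UNIV g" "continuous_on UNIV (\<lambda>q. frechet_derivative g (at q) k)" for k
    using assms C1_fun_continuous[OF assms] by (auto simp: C1_fun_def)
  note c = this[THEN continuous_on_compose2]
  show ?thesis
    by (intro continuous_intros c) auto
qed

subsection \<open>Time-freezing dynamics\<close>

text \<open>Two numbers replace the three multipliers: \<open>\<theta>\<close> is the weight of the
  free dynamics and \<open>\<sigma>\<close> the net tangential weight, third minus second
  multiplier. The normal weight is then \<open>1 - \<theta>\<close>, as both auxiliary fields share
  the normal part.\<close>

lemma F_TF_cases:
  fixes fc :: "real^'n \<Rightarrow> real" and y :: "'n tfstate"
  assumes w: "w \<in> F_TF fv M fc b mu an y u"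
    and cont: "continuous_on UNIV fc" "continuous_on UNIV (grad fc)" "continuous_on UNIV b"
  obtains \<theta> \<sigma> where
    "w = ((\<theta> *\<^sub>R snd (fst y),
           \<theta> *\<^sub>R fv (fst (fst y)) (snd (fst y)) u
           + ((1 - \<theta>) * an) *\<^sub>R (Minv M (fst (fst y)) *v grad fc (fst (fst y)))
           + (\<sigma> * mu * an) *\<^sub>R (Minv M (fst (fst y)) *v b (fst (fst y)))), \<theta>)"
    "0 \<le> \<theta>" "\<theta> \<le> 1"
    "c2 fc y > 0 \<Longrightarrow> \<theta> = 1"
    "c1 fc y < 0 \<Longrightarrow> c2 fc y < 0 \<Longrightarrow> \<theta> = 0"
    "c3 b y > 0 \<Longrightarrow> \<sigma> = - (1 - \<theta>)"
    "c3 b y < 0 \<Longrightarrow> \<sigma> = 1 - \<theta>"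
proof -
  note cc = cont[THEN continuous_on_compose2]
  have c: "continuous_on UNIV (c1 fc)" "continuous_on UNIV (c2 fc)" "continuous_on UNIV (c3 b)"
    unfolding c1_def[abs_def] c2_def[abs_def] c3_def[abs_def]
    by (intro continuous_intros cc; simp)+
  \<comment> \<open>Closed supersets of the closures suffice: a point outside such a set is outside
    the closure, so the corresponding multiplier is zero.\<close>
  have cl1: "closure (region1 fc) \<subseteq> {y. 0 \<le> c1 fc y} \<union> {y. 0 \<le> c2 fc y}"
    by (intro closure_minimal closed_Un closed_Collect_le continuous_on_const c) (auto simp: region1_def)
  have cl2: "closure (region2 fc b) \<subseteq> {y. c2 fc y \<le> 0} \<inter> {y. 0 \<le> c3 b y}"
    by (intro closure_minimal closed_Int closed_Collect_le continuous_on_const c)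
      (auto simp: region2_def regionQ_def)
  have cl3: "closure (region3 fc b) \<subseteq> {y. c2 fc y \<le> 0} \<inter> {y. c3 b y \<le> 0}"
    by (intro closure_minimal closed_Int closed_Collect_le continuous_on_const c)
      (auto simp: region3_def regionQ_def)
  from w obtain \<theta>1 \<theta>2 \<theta>3 where
    weq: "w = \<theta>1 *\<^sub>R f1TF fv y u + \<theta>2 *\<^sub>R (f_aux_n M fc an y + f_aux_t_plus M b (mu * an) y)
      + \<theta>3 *\<^sub>R (f_aux_n M fc an y + f_aux_t_minus M b (mu * an) y)"
    and nonneg: "\<theta>1 \<ge> 0" "\<theta>2 \<ge> 0" "\<theta>3 \<ge> 0" and sum: "\<theta>1 + \<theta>2 + \<theta>3 = 1"
    and z: "y \<notin> closure (region1 fc) \<Longrightarrow> \<theta>1 = 0" "y \<notin> closure (region2 fc b) \<Longrightarrow> \<theta>2 = 0"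
      "y \<notin> closure (region3 fc b) \<Longrightarrow> \<theta>3 = 0"
    unfolding F_TF_def by blast
  have s: "1 - \<theta>1 = \<theta>2 + \<theta>3" using sum by simp
  show thesis
  proof (rule that[of \<theta>1 "\<theta>3 - \<theta>2"])
    show "w = ((\<theta>1 *\<^sub>R snd (fst y),
           \<theta>1 *\<^sub>R fv (fst (fst y)) (snd (fst y)) u
           + ((1 - \<theta>1) * an) *\<^sub>R (Minv M (fst (fst y)) *v grad fc (fst (fst y)))
           + ((\<theta>3 - \<theta>2) * mu * an) *\<^sub>R (Minv M (fst (fst y)) *v b (fst (fst y)))), \<theta>1)"
      unfolding weq s
      by (simp add: f1TF_def f_aux_n_def f_aux_t_plus_def f_aux_t_minus_def Let_def
          matrix_vector_mult_scaleR algebra_simps)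
    show "c2 fc y > 0 \<Longrightarrow> \<theta>1 = 1" using z(2,3) cl2 cl3 sum by force
    show "c1 fc y < 0 \<Longrightarrow> c2 fc y < 0 \<Longrightarrow> \<theta>1 = 0" using z(1) cl1 by force
    show "c3 b y > 0 \<Longrightarrow> \<theta>3 - \<theta>2 = - (1 - \<theta>1)" using z(3) cl3 sum by force
    show "c3 b y < 0 \<Longrightarrow> \<theta>3 - \<theta>2 = 1 - \<theta>1" using z(2) cl2 sum by force
  qed (use nonneg sum in auto)
qed

text \<open>The rows of \<open>Ntr\<close> are the normal and tangent vectors, so its transpose is
  the matrix N. The two orthogonality conditions make \<open>Dtilde\<close> diagonal; nonzero
  diagonal entries let it be inverted entrywise.\<close>

lemma Dtilde_inverse_mult:
  fixes P :: "real^2" and q :: "real^'n" and fc :: "real^'n \<Rightarrow> real" and M :: "real^'n \<Rightarrow> real^'n^'n"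
  defines "n \<equiv> grad fc q" and "Mi \<equiv> Minv M q"
  assumes nb: "n \<bullet> (Mi *v b q) = 0" and bn: "b q \<bullet> (Mi *v n) = 0"
    and D: "n \<bullet> (Mi *v n) \<noteq> 0" and D': "b q \<bullet> (Mi *v b q) \<noteq> 0"
  shows "transpose (Ntr fc b q) *v (matrix_inv (Dtilde M fc b q) *v P) =
    (P $ 1 / (n \<bullet> (Mi *v n))) *\<^sub>R n + (P $ 2 / (b q \<bullet> (Mi *v b q))) *\<^sub>R b q"
proof -
  have tr: "transpose (Ntr fc b q) *v z = z $ 1 *\<^sub>R n + z $ 2 *\<^sub>R b q" for z
    by (simp add: vec_eq_iff matrix_vector_mult_def transpose_def Ntr_def sum_2 n_def mult.commute)
  have N: "(Ntr fc b q *v x) $ 1 = n \<bullet> x" "(Ntr fc b q *v x) $ 2 = b q \<bullet> x" for x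
    by (simp_all add: matrix_vector_mult_def Ntr_def n_def inner_vec_def)
  have Dt: "Dtilde M fc b q *v z = vector [(n \<bullet> (Mi *v n)) * z $ 1, (b q \<bullet> (Mi *v b q)) * z $ 2]" for z
    unfolding Dtilde_def Mi_def[symmetric] matrix_vector_mul_assoc[symmetric] tr
    by (simp add: vec_eq_iff forall_2 N matrix_vector_right_distrib matrix_vector_mult_scaleR inner_add_right nb bn)
  have "z = 0" if "Dtilde M fc b q *v z = 0" for z
    using that D D' by (simp add: Dt vec_eq_iff forall_2)
  then have inv: "invertible (Dtilde M fc b q)"
    using matrix_left_invertible_ker[of "Dtilde M fc b q"] invertible_left_inverse by blast
  then have "matrix_inv (Dtilde M fc b q) ** Dtilde M fc b q = mat 1"
    unfolding invertible_def matrix_inv_def by (rule someI2_ex) blast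
  then have inv_mult: "matrix_inv (Dtilde M fc b q) *v (Dtilde M fc b q *v z) = z" for z
    by (simp add: matrix_vector_mul_assoc)
  have "P = Dtilde M fc b q *v vector [P $ 1 / (n \<bullet> (Mi *v n)), P $ 2 / (b q \<bullet> (Mi *v b q))]"
    using D D' by (simp add: Dt vec_eq_iff forall_2)
  then have "matrix_inv (Dtilde M fc b q) *v P = vector [P $ 1 / (n \<bullet> (Mi *v n)), P $ 2 / (b q \<bullet> (Mi *v b q))]"
    using inv_mult by metis
  then show ?thesis unfolding tr by simp
qed

text \<open>The first component being \<open>phi\<close> is what gives stick and slip the same
  normal force.\<close>

lemma phitilde_nth:
  "phitilde fv fc b x u $ 1 = phi fv fc x u"
  "phitilde fv fc b x u $ 2 = b (fst x) \<bullet> fv (fst x) (snd x) u + dirterm b (fst x) (snd x)"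
  by (simp_all add: phitilde_def phi_def Let_def matrix_vector_mult_def Ntr_def inner_vec_def)

text \<open>The sliding mode itself is part of the conclusion: the curve is shown to remain on
  \<Sigma> at every time. The laws for \<open>y'\<close> are asserted almost everywhere because the
  inclusion is, and slip or stick is decided separately at each time.\<close>

theorem theorem3:
  fixes fv :: "real^'n \<Rightarrow> real^'n \<Rightarrow> real^'m \<Rightarrow> real^'n"
    and M :: "real^'n \<Rightarrow> real^'n^'n"
    and fc :: "real^'n \<Rightarrow> real"
    and b :: "real^'n \<Rightarrow> real^'n"
    and mu an tf :: real
    and u :: "real \<Rightarrow> real^'m"
    and y y' :: "real \<Rightarrow> 'n tfstate"
  assumes fv_C2: "C2_fun (\<lambda>(q, v, w). fv q v w)"
    and M_C2: "C2_fun M"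
    and M_sym: "\<And>q. transpose (M q) = M q"
    and M_pd: "\<And>q x. x \<noteq> 0 \<Longrightarrow> x \<bullet> (M q *v x) > 0"
    and fc_C2: "C2_fun fc"
    and b_C2: "C2_fun b"
    and b_orth: "\<And>q. b q \<bullet> (Minv M q *v grad fc q) = 0"
    and n_nz: "\<And>q. fc q = 0 \<Longrightarrow> grad fc q \<noteq> 0"
    and b_nz: "\<And>q. fc q = 0 \<Longrightarrow> b q \<noteq> 0"
    and mu_pos: "mu > 0"
    and an_pos: "an > 0"
    and sol: "TF_solution fv M fc b mu an u tf y y'"
    and init: "y 0 \<in> Sigma_TF fc"
    and persist: "\<forall>s\<in>{0..tf}. phi fv fc (fst (y s)) (u s) \<le> 0"
  shows "(\<forall>s\<in>{0..tf}. y s \<in> Sigma_TF fc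
            \<and> 0 < gammaTF fv M fc an (fst (y s)) (u s)
            \<and> gammaTF fv M fc an (fst (y s)) (u s) \<le> 1)
       \<and> (AE s in lborel. s \<in> {0..tf} \<longrightarrow>
            (c3 b (y s) \<noteq> 0 \<longrightarrow>
               y' s = gammaTF fv M fc an (fst (y s)) (u s) *\<^sub>R
                        (fSlip fv M fc b mu (fst (y s)) (u s), 1))
          \<and> (c3 b (y s) = 0 \<longrightarrow>
               y' s = gammaTF fv M fc an (fst (y s)) (u s) *\<^sub>R
                        (fStick fv M fc b (fst (y s)) (u s), 1)))"
proof -
  have fc_C1: "C1_fun fc" and b_C1: "C1_fun b" and n_C1: "C1_fun (grad fc)"
    using fc_C2 b_C2 by (auto simp: C2_fun_def C2_fun_C1_grad)
  note cont = C1_fun_continuous[OF fc_C1] C1_fun_continuous[OF n_C1] C1_fun_continuous[OF b_C1]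
  have orth: "grad fc q \<bullet> (Minv M q *v b q) = 0" for q
    using symmetric_matrix_inv_inner[OF M_pd M_sym, of "grad fc q" q "b q"] b_orth[of q]
    by (simp add: Minv_def)
  have Minv_pos: "x \<bullet> (Minv M q *v x) > 0" if "x \<noteq> 0" for x q
    using pd_matrix_inv_pos[OF M_pd that] by (simp add: Minv_def)
  \<comment> \<open>Away from contact points the gradient may vanish, so strict positivity has to
    wait until contact is established.\<close>
  have D_nonneg: "Dfun M fc q \<ge> 0" for q
    using Minv_pos[of "grad fc q" q] by (cases "grad fc q = 0") (auto simp: Dfun_def)

  \<comment> \<open>\<open>pg\<close>, \<open>pv (grad fc)\<close> and \<open>pv b\<close> will be
    the chain-rule derivatives of \<open>g\<close>, \<open>h\<close> and \<open>k\<close>.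
    \<open>D\<close> and \<open>Db\<close> are the diagonal entries of \<open>Dtilde\<close>, and
    \<open>\<psi>\<close> is the tangential counterpart of \<open>\<phi>\<close>.\<close>
  define g h k where "g s = c1 fc (y s)" and "h s = c2 fc (y s)" and "k s = c3 b (y s)" for s
  define \<phi> where "\<phi> s = phi fv fc (fst (y s)) (u s)" for s
  define D where "D s = Dfun M fc (fst (fst (y s)))" for s
  define Db where "Db s = b (fst (fst (y s))) \<bullet> (Minv M (fst (fst (y s))) *v b (fst (fst (y s))))" for s
  define \<psi> where "\<psi> s = phitilde fv fc b (fst (y s)) (u s) $ 2" for s
  define pg where "pg s = grad fc (fst (fst (y s))) \<bullet> fst (fst (y' s))" for s
  define pv where "pv a s = a (fst (fst (y s))) \<bullet> snd (fst (y' s)) +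
      frechet_derivative a (at (fst (fst (y s)))) (fst (fst (y' s))) \<bullet> snd (fst (y s))"
    for a :: "real^'n \<Rightarrow> real^'n" and s

  have "integral {0..s} y' = y s - y 0" if "s \<in> {0..tf}" for s
  proof -
    have "y s = y 0 + integral {0..s} y'"
      using sol that unfolding TF_solution_def by blast
    then show ?thesis by (simp only: add_diff_cancel_left')
  qed
  then have ac: "ac_deriv y y' 0 tf"
    using sol unfolding ac_deriv_def TF_solution_def by blast
  have ac_g: "ac_deriv g pg 0 tf"
    unfolding g_def[abs_def] pg_def[abs_def]
    by (rule ac_deriv_C1_comp[where \<Phi> = "c1 fc", OF has_derivative_c1[OF fc_C1] _ ac])
      (intro continuous_intros continuous_on_compose2[OF cont(2)], auto)
  have ac_h: "ac_deriv h (pv (grad fc)) 0 tf"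
    unfolding h_def[abs_def] pv_def[abs_def] c2_def
    by (rule ac_deriv_C1_comp[where \<Phi> = "\<lambda>y. grad fc (fst (fst y)) \<bullet> snd (fst y)",
          OF has_derivative_velocity[OF n_C1] continuous_velocity_derivative[OF n_C1] ac])
  have ac_k: "ac_deriv k (pv b) 0 tf"
    unfolding k_def[abs_def] pv_def[abs_def] c3_def
    by (rule ac_deriv_C1_comp[where \<Phi> = "\<lambda>y. b (fst (fst y)) \<bullet> snd (fst y)",
          OF has_derivative_velocity[OF b_C1] continuous_velocity_derivative[OF b_C1] ac])

  \<comment> \<open>Orthogonality removes the cross terms: \<open>\<sigma>\<close> does not affect
    the normal acceleration, and the normal auxiliary field does not affect the tangential one. The
    two weights can therefore be determined one after the other.\<close>
  have dyn: "AE s in lborel. s \<in> {0..tf} \<longrightarrow> (\<exists>\<theta> \<sigma>.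
      y' s = ((\<theta> *\<^sub>R snd (fst (y s)),
           \<theta> *\<^sub>R fv (fst (fst (y s))) (snd (fst (y s))) (u s)
           + ((1 - \<theta>) * an) *\<^sub>R (Minv M (fst (fst (y s))) *v grad fc (fst (fst (y s))))
           + (\<sigma> * mu * an) *\<^sub>R (Minv M (fst (fst (y s))) *v b (fst (fst (y s))))), \<theta>) \<and>
      0 \<le> \<theta> \<and> \<theta> \<le> 1 \<and> pg s = \<theta> * h s \<and> pv (grad fc) s = \<theta> * \<phi> s + (1 - \<theta>) * (D s * an) \<and>
      pv b s = \<theta> * \<psi> s + \<sigma> * mu * an * Db s \<and>
      (h s > 0 \<longrightarrow> \<theta> = 1) \<and> (g s < 0 \<longrightarrow> h s < 0 \<longrightarrow> \<theta> = 0) \<and>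
      (k s > 0 \<longrightarrow> \<sigma> = - (1 - \<theta>)) \<and> (k s < 0 \<longrightarrow> \<sigma> = 1 - \<theta>))"
    (is "AE s in lborel. s \<in> {0..tf} \<longrightarrow> ?dyn s")
  proof -
    have main: "?dyn s" if F: "y' s \<in> F_TF fv M fc b mu an (y s) (u s)" for s
    proof -
      let ?q = "fst (fst (y s))" and ?v = "snd (fst (y s))"
      obtain \<theta> \<sigma> where *:
        "y' s = ((\<theta> *\<^sub>R ?v, \<theta> *\<^sub>R fv ?q ?v (u s) + ((1 - \<theta>) * an) *\<^sub>R (Minv M ?q *v grad fc ?q)
           + (\<sigma> * mu * an) *\<^sub>R (Minv M ?q *v b ?q)), \<theta>)"
        "0 \<le> \<theta>" "\<theta> \<le> 1" "c2 fc (y s) > 0 \<Longrightarrow> \<theta> = 1"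
        "c1 fc (y s) < 0 \<Longrightarrow> c2 fc (y s) < 0 \<Longrightarrow> \<theta> = 0"
        "c3 b (y s) > 0 \<Longrightarrow> \<sigma> = - (1 - \<theta>)" "c3 b (y s) < 0 \<Longrightarrow> \<sigma> = 1 - \<theta>"
        using F_TF_cases[OF F cont] by blast
      \<comment> \<open>The position moves with velocity \<open>\<theta> *\<^sub>R ?v\<close>, so
        linearity pulls out one factor \<open>\<theta>\<close>.\<close>
      have dir: "frechet_derivative a (at ?q) (\<theta> *\<^sub>R ?v) \<bullet> ?v = \<theta> * dirterm a ?q ?v"
        if "C1_fun a" for a
        using linear_scale[OF linear_frechet_derivative[of a "at ?q"], of \<theta> ?v] that
        by (simp add: dirterm_eq[OF that] C1_fun_def)
      have "pg s = \<theta> * h s"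
        by (simp add: pg_def h_def c2_def *(1))
      moreover have "pv (grad fc) s = \<theta> * \<phi> s + (1 - \<theta>) * (D s * an)"
        by (simp add: pv_def *(1) inner_add_right dir[OF n_C1] orth \<phi>_def phi_def Let_def
            D_def Dfun_def algebra_simps)
      moreover have "pv b s = \<theta> * \<psi> s + \<sigma> * mu * an * Db s"
        by (simp add: pv_def *(1) inner_add_right dir[OF b_C1] b_orth \<psi>_def phitilde_nth
            Db_def algebra_simps)
      ultimately show ?thesis
        using * unfolding g_def h_def k_def by blast
    qed
    have "AE s in lborel. s \<in> {0..tf} \<longrightarrow> y' s \<in> F_TF fv M fc b mu an (y s) (u s)"
      using sol unfolding TF_solution_def by blast
    then show ?thesis
      by (rule eventually_mono) (intro impI main, erule mp, assumption)
  qed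

  have contact: "g s = 0 \<and> h s = 0" if "s \<in> {0..tf}" for s
    using ac_g ac_h _ _ _ _ _ that
  proof (rule persistent_contact)
    show "g 0 = 0" "h 0 = 0"
      using init by (auto simp: g_def h_def Sigma_TF_def)
    show "\<phi> s \<le> 0" if "s \<in> {0..tf}" for s using persist that by (simp add: \<phi>_def)
    show "D s * an \<ge> 0" for s using D_nonneg an_pos by (simp add: D_def)
    show "AE s in lborel. s \<in> {0..tf} \<longrightarrow> (\<exists>\<theta>\<ge>0. \<theta> \<le> 1 \<and> pg s = \<theta> * h s \<and>
       pv (grad fc) s = \<theta> * \<phi> s + (1 - \<theta>) * (D s * an) \<and> (h s > 0 \<longrightarrow> \<theta> = 1) \<and>
       (g s < 0 \<longrightarrow> h s < 0 \<longrightarrow> \<theta> = 0))"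
      using dyn by (rule eventually_mono) blast
  qed
  then have fc0: "fc (fst (fst (y s))) = 0" if "s \<in> {0..tf}" for s
    using that by (simp add: g_def c1_def)
  have D_pos: "D s > 0" and Db_pos: "Db s > 0" if "s \<in> {0..tf}" for s
    using Minv_pos n_nz[OF fc0[OF that]] b_nz[OF fc0[OF that]] by (auto simp: D_def Dfun_def Db_def)
  have den: "D s * an - \<phi> s > 0" if "s \<in> {0..tf}" for s
  proof -
    have "D s * an > 0" using D_pos[OF that] an_pos by simp
    moreover have "\<phi> s \<le> 0" using persist that by (simp add: \<phi>_def)
    ultimately show ?thesis by linarith
  qed
  have gamma: "gammaTF fv M fc an (fst (y s)) (u s) = D s * an / (D s * an - \<phi> s)" for s
    by (simp add: gammaTF_def D_def \<phi>_def)

  have "y s \<in> Sigma_TF fc \<and> 0 < gammaTF fv M fc an (fst (y s)) (u s)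
            \<and> gammaTF fv M fc an (fst (y s)) (u s) \<le> 1" if "s \<in> {0..tf}" for s
    using contact[OF that] den[OF that] D_pos[OF that] an_pos persist that
    by (simp add: gamma Sigma_TF_def g_def h_def \<phi>_def)
  moreover have "AE s in lborel. s \<in> {0..tf} \<longrightarrow>
            (c3 b (y s) \<noteq> 0 \<longrightarrow>
               y' s = gammaTF fv M fc an (fst (y s)) (u s) *\<^sub>R
                        (fSlip fv M fc b mu (fst (y s)) (u s), 1))
          \<and> (c3 b (y s) = 0 \<longrightarrow>
               y' s = gammaTF fv M fc an (fst (y s)) (u s) *\<^sub>R
                        (fStick fv M fc b (fst (y s)) (u s), 1))"
    using dyn ac_deriv_zero_on_zeros[OF ac_h] ac_deriv_zero_on_zeros[OF ac_k]
  proof eventually_elim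
    case (elim s)
    show ?case
    proof
      assume s: "s \<in> {0..tf}"
      let ?q = "fst (fst (y s))" and ?v = "snd (fst (y s))"
      let ?n = "Minv M ?q *v grad fc ?q" and ?b = "Minv M ?q *v b ?q"
      from elim(1) s obtain \<theta> \<sigma> where
        y': "y' s = ((\<theta> *\<^sub>R ?v, \<theta> *\<^sub>R fv ?q ?v (u s) + ((1 - \<theta>) * an) *\<^sub>R ?n + (\<sigma> * mu * an) *\<^sub>R ?b), \<theta>)"
        and ph: "pv (grad fc) s = \<theta> * \<phi> s + (1 - \<theta>) * (D s * an)"
        and pk: "pv b s = \<theta> * \<psi> s + \<sigma> * mu * an * Db s"
        and \<sigma>: "k s > 0 \<longrightarrow> \<sigma> = - (1 - \<theta>)" "k s < 0 \<longrightarrow> \<sigma> = 1 - \<theta>"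
        by blast
      \<comment> \<open>Since \<open>h\<close> is zero throughout, its derivative vanishes almost
        everywhere. Solving for \<open>\<theta>\<close> gives the rescaling factor;
        \<open>rate\<close> identifies the weighted normal auxiliary field with the rescaled contact
        force.\<close>
      have "\<theta> * \<phi> s + (1 - \<theta>) * (D s * an) = 0"
        using elim(2) s contact[OF s] ph by simp
      then have rate: "\<theta> * (\<phi> s / D s) = - ((1 - \<theta>) * an)" and "\<theta> * (D s * an - \<phi> s) = D s * an"
        using D_pos[OF s] by (auto simp: field_simps)
      then have \<theta>: "gammaTF fv M fc an (fst (y s)) (u s) = \<theta>"
        using den[OF s] by (simp add: gamma field_simps)
      have slip: "y' s = \<theta> *\<^sub>R (fSlip fv M fc b mu (fst (y s)) (u s), 1)" if "k s \<noteq> 0"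
      proof -
        \<comment> \<open>The sign of the tangential velocity; it merges the two slip directions, so
          that \<open>\<sigma>\<close> is minus \<open>r\<close> times the normal weight, which is
          Coulomb's law.\<close>
        define r where "r = k s / \<bar>k s\<bar>"
        have "fSlip fv M fc b mu (fst (y s)) (u s) =
          (?v, fv ?q ?v (u s) - (\<phi> s / D s) *\<^sub>R (?n - (mu * r) *\<^sub>R ?b))"
          by (simp add: fSlip_def Let_def \<phi>_def D_def r_def k_def c3_def matrix_vector_mult_scaleR
              matrix_vector_mult_diff_distrib)
        then have eq: "\<theta> *\<^sub>R (fSlip fv M fc b mu (fst (y s)) (u s), 1 :: real) =
          ((\<theta> *\<^sub>R ?v, \<theta> *\<^sub>R fv ?q ?v (u s) - (\<theta> * (\<phi> s / D s)) *\<^sub>R (?n - (mu * r) *\<^sub>R ?b)), \<theta>)"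
          by (simp add: scaleR_diff_right)
        have \<sigma>_eq: "\<sigma> = - ((1 - \<theta>) * r)"
          unfolding r_def using \<sigma> that by (cases "k s > 0") auto
        show ?thesis
          unfolding eq y' rate \<sigma>_eq by (simp add: algebra_simps)
      qed
      have stick: "y' s = \<theta> *\<^sub>R (fStick fv M fc b (fst (y s)) (u s), 1)" if "k s = 0"
      proof -
        \<comment> \<open>The derivative of \<open>k\<close> vanishes at almost every zero of
          \<open>k\<close>, even if the zeros fill no interval. \<open>fric\<close> is the
          tangential analogue of \<open>rate\<close> and fixes \<open>\<sigma>\<close>.\<close>
        have "\<theta> * \<psi> s + \<sigma> * mu * an * Db s = 0"
          using elim(3) s that pk by simp
        then have fric: "\<theta> * (\<psi> s / Db s) = - (\<sigma> * mu * an)"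
          using Db_pos[OF s] by (auto simp: field_simps)
        have "fStick fv M fc b (fst (y s)) (u s) =
          (?v, fv ?q ?v (u s) - ((\<phi> s / D s) *\<^sub>R ?n + (\<psi> s / Db s) *\<^sub>R ?b))"
          using D_pos[OF s, THEN less_imp_neq, symmetric] Db_pos[OF s, THEN less_imp_neq, symmetric]
          by (simp del: transpose_matrix_vector add: fStick_def Let_def Dtilde_inverse_mult orth b_orth \<phi>_def \<psi>_def phitilde_nth(1)
              D_def Dfun_def Db_def matrix_vector_mult_scaleR matrix_vector_right_distrib)
        then have "\<theta> *\<^sub>R (fStick fv M fc b (fst (y s)) (u s), 1 :: real) =
          ((\<theta> *\<^sub>R ?v, \<theta> *\<^sub>R fv ?q ?v (u s)
             - ((\<theta> * (\<phi> s / D s)) *\<^sub>R ?n + (\<theta> * (\<psi> s / Db s)) *\<^sub>R ?b)), \<theta>)"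
          by (simp add: scaleR_diff_right scaleR_add_right)
        then show ?thesis
          unfolding y' rate fric by (simp add: algebra_simps)
      qed
      from slip stick show "(c3 b (y s) \<noteq> 0 \<longrightarrow>
               y' s = gammaTF fv M fc an (fst (y s)) (u s) *\<^sub>R
                        (fSlip fv M fc b mu (fst (y s)) (u s), 1))
          \<and> (c3 b (y s) = 0 \<longrightarrow>
               y' s = gammaTF fv M fc an (fst (y s)) (u s) *\<^sub>R
                        (fStick fv M fc b (fst (y s)) (u s), 1))"
        unfolding \<theta> k_def by blast
    qed
  qed
  ultimately show ?thesis by blast
qed

end
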